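(* Let $m\ge 2$ be an integer, and let $G$ be a finite abelian group whose exponent divides $m$. Then for every non-empty subset $A\subseteq G$ and every generating subset $S\subseteq G$, $$\partial_S(A)\ \ge\ \frac{e}{m}\,|A|\,\ln\frac{|G|}{|A|},$$ where $e=2.718\ldots$ is Euler's number.
   Context: For subsets $S,A$ of a finite abelian group $G$ (written additively), $\partial_S(A):=|\{(a,s)\in A\times S:\ a+s\notin A\}|$, i.e. the number of edges of the directed Cayley graph of $G$ induced by $S$ going from $A$ to $G\setminus A$. *)

theory Defs
  imports Complex_Main "HOL-Algebra.Multiplicative_Group" "HOL-Algebra.Generated_Groups"
begin

(* HOL-Algebra writes groups multiplicatively, so a + s becomes a \<otimes> s
   and n x becomes x [^] n throughout. *)

definition group_exponent :: "('a, 'b) monoid_scheme \<Rightarrow> nat" where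
  "group_exponent G = (LCM x\<in>carrier G. group.ord G x)"

lemma (in group) group_exponent_dvd_iff:
  "group_exponent G dvd n \<longleftrightarrow> (\<forall>x\<in>carrier G. x [^] n = \<one>)"
  by (simp add: group_exponent_def Lcm_dvd_iff pow_eq_id)

definition edge_boundary :: "('a, 'b) monoid_scheme \<Rightarrow> 'a set \<Rightarrow> 'a set \<Rightarrow> nat" where
  "edge_boundary G S A = card {(a, s) \<in> A \<times> S. a \<otimes>\<^bsub>G\<^esub> s \<notin> A}"

end

theory Submission
  imports Defs
begin

text \<open>
  Generators are added one at a time. If \<open>H\<close> is generated by \<open>S\<close> and \<open>k\<close> is the least positive
  integer with \<open>s\<^sup>k \<in> H\<close>, the group generated by \<open>insert s S\<close> is the disjoint union of
  \<open>H, s H, \<dots>, s\<^sup>k\<^sup>-\<^sup>1 H\<close>. A set \<open>A\<close> splits into slices of sizes \<open>c\<^sub>0, \<dots>, c\<^sub>k\<^sub>-\<^sub>1\<close>. The edges in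
  direction \<open>S\<close> are handled by induction slice by slice, and the edges in direction \<open>s\<close> run
  cyclically through the slices, so there are at least \<open>Max c - Min c\<close> of them. Since \<open>k \<le> m\<close>, the
  induction step reduces to bounding the Jensen gap of \<open>x ln x\<close>:
  \<open>\<Sum> c\<^sub>i ln (c\<^sub>i / c) \<le> k (Max c - Min c) / e\<close>, where \<open>c\<close> is the mean. Translating all \<open>c\<^sub>i\<close>
  by \<open>- Min c\<close> only increases the gap, and for \<open>0 \<le> c\<^sub>i \<le> d\<close> the gap is at most
  \<open>k c ln (d / c) \<le> k d / e\<close>.
\<close>

section \<open>The Jensen gap of \<open>x ln x\<close>\<close>

text \<open>With \<open>u = d / x\<close> this is \<open>ln u \<le> u / e\<close>, the tangent bound
  \<open>ln t \<le> t - 1\<close> taken at \<open>t = u / e\<close>; it is the source of the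
  constant \<open>e\<close>.\<close>

lemma mult_ln_divide_le:
  fixes x d :: real
  assumes "0 \<le> x" "0 \<le> d"
  shows "x * ln (d / x) \<le> d / exp 1"
proof (cases "x = 0 \<or> d = 0")
  case False
  then have pos: "x > 0" "d > 0" using assms by auto
  then have "ln (d / x / exp 1) \<le> d / x / exp 1 - 1"
    by (intro ln_le_minus_one) simp
  then have "ln (d / x) \<le> d / x / exp 1"
    using pos ln_div[of "d / x" "exp 1"] by simp
  then have "x * ln (d / x) \<le> x * (d / x / exp 1)"
    using pos by (intro mult_left_mono) auto
  then show ?thesis using pos by simp
qed (use assms in auto)

text \<open>The log sum inequality for the pairs \<open>(a, a)\<close> and \<open>(y, z)\<close>,
  whose first term \<open>a * ln (a / a)\<close> vanishes. It is the termwise form of the claim that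
  translating down increases the gap.\<close>

lemma log_sum_translate:
  fixes a y z :: real
  assumes "0 \<le> a" "0 \<le> y" "0 < z"
  shows "(a + y) * ln ((a + y) / (a + z)) \<le> y * ln (y / z)"
proof (cases "y = 0")
  case True
  have "a * ln (a / (a + z)) \<le> 0"
    using assms by (cases "a = 0") (auto intro!: mult_nonneg_nonpos)
  then show ?thesis using True by simp
next
  case False
  then have y: "y > 0" using assms by simp
  define r where "r = (a + y) / (a + z)"
  have r: "r > 0" using assms y by (simp add: r_def)
  \<comment> \<open>Both logarithms are bounded by \<open>ln t \<le> t - 1\<close>; weighted by
    \<open>a\<close> and \<open>y\<close>, the two right-hand sides add up to
    \<open>r * (a + z) - (a + y) = 0\<close>.\<close>
  have "a * ln r \<le> a * (r - 1)"
    using assms r by (intro mult_left_mono ln_le_minus_one)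
  moreover have "y * ln (r * z / y) \<le> y * (r * z / y - 1)"
    using assms r y by (intro mult_left_mono ln_le_minus_one) auto
  moreover have "y * ln (r * z / y) = y * ln r - y * ln (y / z)"
    using assms r y by (simp add: ln_div ln_mult algebra_simps)
  moreover have "a * (r - 1) + y * (r * z / y - 1) = r * (a + z) - (a + y)"
    using y by (simp add: algebra_simps)
  moreover have "r * (a + z) = a + y" using assms by (simp add: r_def)
  ultimately show ?thesis by (simp add: r_def[symmetric] algebra_simps)
qed

lemma sum_mult_ln_mean_le:
  fixes c :: "nat \<Rightarrow> real"
  assumes "0 < k" "0 \<le> a" and range: "\<And>i. i < k \<Longrightarrow> a \<le> c i \<and> c i \<le> b"
  defines "\<mu> \<equiv> (\<Sum>i<k. c i) / k"
  shows "(\<Sum>i<k. c i * ln (c i / \<mu>)) \<le> k * (b - a) / exp 1"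
proof -
  \<comment> \<open>\<open>z\<close> is the mean of the translated values \<open>c i - a\<close>; if
    it is 0, then all \<open>c i\<close> equal the mean and the gap vanishes.\<close>
  define z where "z = \<mu> - a"
  have sumz: "(\<Sum>i<k. c i - a) = k * z"
    using \<open>0 < k\<close> by (simp add: z_def \<mu>_def sum_subtractf field_simps)
  moreover have "(\<Sum>i<k. c i - a) \<ge> 0"
    using range by (intro sum_nonneg) auto
  ultimately have "z \<ge> 0" using \<open>0 < k\<close> by (simp add: zero_le_mult_iff)
  have ab: "a \<le> b" using range[OF \<open>0 < k\<close>] by simp
  show ?thesis
  proof (cases "z = 0")
    case True
    then have "c i = a" if "i < k" for i
      using sumz range that sum_nonneg_eq_0_iff[of "{..<k}" "\<lambda>i. c i - a"] by auto
    moreover have "\<mu> = a" using True by (simp add: z_def)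
    ultimately have "(\<Sum>i<k. c i * ln (c i / \<mu>)) = 0"
      by (intro sum.neutral) (cases "a = 0"; simp)
    then show ?thesis using ab by simp
  next
    case False
    then have z: "z > 0" using \<open>z \<ge> 0\<close> by simp
    have "(\<Sum>i<k. c i * ln (c i / \<mu>)) \<le> (\<Sum>i<k. (c i - a) * ln ((b - a) / z))"
    proof (rule sum_mono)
      fix i assume "i \<in> {..<k}"
      then have i: "a \<le> c i" "c i \<le> b" using range by auto
      have "c i * ln (c i / \<mu>) \<le> (c i - a) * ln ((c i - a) / z)"
        using log_sum_translate[of a "c i - a" z] assms i z by (simp add: z_def)
      also have "\<dots> \<le> (c i - a) * ln ((b - a) / z)"
        using i z by (cases "c i = a") (auto intro!: mult_left_mono divide_right_mono)
      finally show "c i * ln (c i / \<mu>) \<le> (c i - a) * ln ((b - a) / z)" .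
    qed
    also have "\<dots> = k * (z * ln ((b - a) / z))"
      by (simp add: sumz flip: sum_distrib_right)
    also have "\<dots> \<le> k * ((b - a) / exp 1)"
      using mult_ln_divide_le[of z "b - a"] z ab by (intro mult_left_mono) auto
    finally show ?thesis by simp
  qed
qed

section \<open>Descents of a cyclic sequence\<close>

lemma diff_le_sum_descents:
  fixes c :: "nat \<Rightarrow> real"
  assumes "p \<le> q" and "\<And>i. c i - c (Suc i) \<le> f i"
  shows "c p - c q \<le> (\<Sum>i=p..<q. f i)"
  using assms(1)
proof (induction q rule: dec_induct)
  case (step n)
  then show ?case using assms(2)[of n] by simp
qed simp

lemma cyclic_diff_le_sum_descents:
  fixes c :: "nat \<Rightarrow> real"
  assumes "p < k" "q < k" "c k = c 0"
    and f: "\<And>i. c i - c (Suc i) \<le> f i" "\<And>i. 0 \<le> f i"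
  shows "c p - c q \<le> (\<Sum>i<k. f i)"
proof (cases "p \<le> q")
  case True
  have "c p - c q \<le> (\<Sum>i=p..<q. f i)" using True f by (intro diff_le_sum_descents)
  also have "\<dots> \<le> (\<Sum>i<k. f i)" using assms by (intro sum_mono2) auto
  finally show ?thesis .
next
  case False
  \<comment> \<open>The path from \<open>p\<close> up to \<open>q\<close> wraps around at
    \<open>k\<close>, identified with 0. Its two arcs are disjoint because
    \<open>q < p\<close>.\<close>
  have "c p - c k \<le> (\<Sum>i=p..<k. f i)" using assms by (intro diff_le_sum_descents) auto
  moreover have "c 0 - c q \<le> (\<Sum>i=0..<q. f i)" using f by (intro diff_le_sum_descents) auto
  moreover have "(\<Sum>i=p..<k. f i) + (\<Sum>i=0..<q. f i) = (\<Sum>i\<in>{p..<k} \<union> {0..<q}. f i)"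
    using False by (intro sum.union_disjoint[symmetric]) auto
  moreover have "\<dots> \<le> (\<Sum>i<k. f i)" using assms by (intro sum_mono2) auto
  ultimately show ?thesis using assms(3) by linarith
qed

section \<open>Adjoining a generator\<close>

lemma (in group) subgroup_nat_pow_closed:
  assumes "subgroup H G" "x \<in> H"
  shows "x [^] (n::nat) \<in> H"
  by (induction n) (use assms in \<open>auto intro: subgroup.one_closed subgroup.m_closed\<close>)

text \<open>In a finite group \<open>inv s\<close> is itself a power of \<open>s\<close> with
  natural exponent, so no negative exponents are needed.\<close>

lemma (in comm_group) generate_insert_eq:
  assumes "finite (carrier G)" "S \<subseteq> carrier G" "s \<in> carrier G"
  shows "generate G (insert s S) = {s [^] i \<otimes> h | (i::nat) h. h \<in> generate G S}" (is "_ = ?R")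
proof
  have H: "subgroup (generate G S) G" using generate_is_subgroup assms by auto
  have K: "subgroup (generate G (insert s S)) G" using generate_is_subgroup assms by auto
  have HK: "generate G S \<subseteq> generate G (insert s S)" by (intro mono_generate) auto
  have sK: "s [^] i \<in> generate G (insert s S)" for i :: nat
    using subgroup_nat_pow_closed[OF K] generate.incl[of s "insert s S" G] by simp
  show "?R \<subseteq> generate G (insert s S)"
    using HK sK subgroup.m_closed[OF K] by blast
  have Hc: "h \<in> carrier G" if "h \<in> generate G S" for h
    using subgroup.mem_carrier[OF H] that .
  have in_R: "h \<in> ?R" if "h \<in> generate G S" for h
    using that Hc[OF that] by (intro CollectI exI[of _ "0::nat"] exI[of _ h]) simp
  show "generate G (insert s S) \<subseteq> ?R"
  proof
    fix x assume "x \<in> generate G (insert s S)"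
    then show "x \<in> ?R"
    proof induction
      case one
      show ?case by (intro in_R generate.one)
    next
      case (incl h)
      show ?case
      proof (cases "h \<in> S")
        case True
        then show ?thesis by (intro in_R generate.incl)
      next
        case False
        then have "h = s [^] (1::nat) \<otimes> \<one>" using incl assms by simp
        then show ?thesis using generate.one by blast
      qed
    next
      case (inv h)
      show ?case
      proof (cases "h \<in> S")
        case True
        then show ?thesis by (intro in_R generate.inv)
      next
        case False
        have "s [^] (ord s - 1) \<otimes> s = s [^] ord s"
          using ord_ge_1[OF assms(1,3)] nat_pow_Suc[of s "ord s - 1"] by simp
        then have "inv s = s [^] (ord s - 1)"
          using assms by (intro inv_equality) (auto simp: pow_ord_eq_1)
        then have "inv h = s [^] (ord s - 1) \<otimes> \<one>"
          using False inv assms by simp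
        then show ?thesis using generate.one by blast
      qed
    next
      case (eng x y)
      then obtain i j :: nat and g h where
        *: "x = s [^] i \<otimes> g" "g \<in> generate G S" "y = s [^] j \<otimes> h" "h \<in> generate G S"
        by blast
      have "x \<otimes> y = s [^] (i + j) \<otimes> (g \<otimes> h)"
        using * Hc assms by (simp add: nat_pow_mult[symmetric] m_ac)
      moreover have "g \<otimes> h \<in> generate G S" using *(2,4) by (rule generate.eng)
      ultimately show ?case by blast
    qed
  qed
qed

text \<open>Here \<open>k\<close> is the order of \<open>s\<close> modulo
  \<open>generate G S\<close>, which is at most \<open>ord s\<close>.\<close>

lemma (in comm_group) generate_insert_slices:
  assumes "finite (carrier G)" "S \<subseteq> carrier G" "s \<in> carrier G"
  obtains k :: nat where "0 < k" "k \<le> ord s" "s [^] k \<in> generate G S"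
    "bij_betw (\<lambda>(i, h). s [^] i \<otimes> h) ({..<k} \<times> generate G S) (generate G (insert s S))"
proof -
  define H where "H = generate G S"
  have H: "subgroup H G" unfolding H_def using generate_is_subgroup assms by auto
  note Hc = subgroup.mem_carrier[OF H]
  define k :: nat where "k = (LEAST n. 0 < n \<and> s [^] n \<in> H)"
  have ordP: "0 < ord s \<and> s [^] ord s \<in> H"
    using ord_ge_1[OF assms(1,3)] pow_ord_eq_1 subgroup.one_closed[OF H] assms by auto
  have k: "0 < k" "s [^] k \<in> H"
    using LeastI[of "\<lambda>n. 0 < n \<and> s [^] n \<in> H", OF ordP] unfolding k_def by auto
  have k_le: "k \<le> n" if "0 < n" "s [^] n \<in> H" for n
    unfolding k_def using that by (intro Least_le) auto
  have no_collision: False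
    if "i < j" "j < k" "g \<in> H" "h \<in> H" "s [^] i \<otimes> g = s [^] j \<otimes> h" for i j g h
  proof -
    \<comment> \<open>Cancelling \<open>s [^] i\<close> puts \<open>s [^] (j - i)\<close> into
      \<open>H\<close> with \<open>0 < j - i < k\<close>, against the minimality of
      \<open>k\<close>.\<close>
    have "s [^] i \<otimes> (s [^] (j - i) \<otimes> h) = s [^] i \<otimes> g"
      using that assms Hc by (simp add: m_assoc[symmetric] nat_pow_mult)
    then have "s [^] (j - i) \<otimes> h = g"
      using Units_l_cancel[of "s [^] i" "s [^] (j - i) \<otimes> h" g] that(3,4) assms Hc by simp
    then have "s [^] (j - i) = g \<otimes> inv h"
      using that assms Hc inv_solve_right'[of "s [^] (j - i)" g h] by auto
    then have "s [^] (j - i) \<in> H"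
      using that H by (simp add: subgroup.m_closed subgroup.m_inv_closed)
    then show False using k_le[of "j - i"] that by auto
  qed
  have "inj_on (\<lambda>(i, h). s [^] i \<otimes> h) ({..<k} \<times> H)"
  proof (rule inj_onI, clarify)
    fix i j g h
    assume *: "i < k" "g \<in> H" "j < k" "h \<in> H" "s [^] i \<otimes> g = s [^] j \<otimes> h"
    then have "i = j" using no_collision[of i j g h] no_collision[of j i h g] by force
    then show "i = j \<and> g = h" using * assms Hc by (simp add: Units_l_cancel)
  qed
  moreover have "(\<lambda>(i, h). s [^] i \<otimes> h) ` ({..<k} \<times> H) = generate G (insert s S)"
  proof -
    have "s [^] i \<otimes> h \<in> (\<lambda>(i, h). s [^] i \<otimes> h) ` ({..<k} \<times> H)" if "h \<in> H" for i :: nat and h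
    proof -
      \<comment> \<open>Division with remainder: the power of \<open>s [^] k\<close> is absorbed
        into \<open>H\<close>.\<close>
      have "s [^] i = s [^] (i mod k) \<otimes> (s [^] k) [^] (i div k)"
        using assms by (simp add: nat_pow_pow nat_pow_mult)
      moreover have p: "(s [^] k) [^] (i div k) \<in> H"
        using subgroup_nat_pow_closed[OF H] k by simp
      ultimately have "s [^] i \<otimes> h = s [^] (i mod k) \<otimes> ((s [^] k) [^] (i div k) \<otimes> h)"
        using assms that Hc by (simp add: m_assoc)
      moreover have "(s [^] k) [^] (i div k) \<otimes> h \<in> H"
        using p that subgroup.m_closed[OF H] by blast
      ultimately show ?thesis using k(1)
        by (intro image_eqI[of _ _ "(i mod k, (s [^] k) [^] (i div k) \<otimes> h)"]) auto
    qed
    then show ?thesis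
      unfolding generate_insert_eq[OF assms] H_def[symmetric] by auto
  qed
  ultimately show ?thesis
    using that[of k] k k_le[of "ord s"] ordP by (simp add: bij_betw_def H_def)
qed

lemma card_eq_sum_slices:
  assumes bij: "bij_betw (\<lambda>(i, h). f i h) ({..<k} \<times> H) K" and "finite H" "B \<subseteq> K"
  shows "card B = (\<Sum>i<k::nat. card {h \<in> H. f i h \<in> B})"
proof -
  let ?P = "SIGMA i:{..<k}. {h \<in> H. f i h \<in> B}"
  have "inj_on (\<lambda>(i, h). f i h) ?P"
    using bij by (auto simp: bij_betw_def intro: inj_on_subset)
  moreover have "(\<lambda>(i, h). f i h) ` ?P = B"
    using bij \<open>B \<subseteq> K\<close> by (force simp: bij_betw_def)
  ultimately have "card B = card ?P"
    using bij_betw_same_card[of "\<lambda>(i, h). f i h" ?P B] by (simp add: bij_betw_def)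
  then show ?thesis using \<open>finite H\<close> by simp
qed

section \<open>The isoperimetric inequality\<close>

lemma edge_boundary_eq_sum:
  assumes "finite A" "finite S"
  shows "edge_boundary G S A = (\<Sum>t\<in>S. card {a \<in> A. a \<otimes>\<^bsub>G\<^esub> t \<notin> A})"
proof -
  have "edge_boundary G S A = card (SIGMA t:S. {a \<in> A. a \<otimes>\<^bsub>G\<^esub> t \<notin> A})"
    unfolding edge_boundary_def
    by (rule bij_betw_same_card[of prod.swap]) (auto simp: bij_betw_def inj_on_def image_iff)
  then show ?thesis using assms by simp
qed

text \<open>Stated for the subgroup that \<open>S\<close> generates, so that induction on
  \<open>S\<close> applies. \<open>A\<close> may be empty because slices can be empty.\<close>

lemma (in comm_group) edge_boundary_generate_ge:
  assumes fin: "finite (carrier G)" and "0 < m" and exponent: "\<And>x. x \<in> carrier G \<Longrightarrow> x [^] m = \<one>"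
    and "S \<subseteq> carrier G" "A \<subseteq> generate G S"
  shows "exp 1 / real m * real (card A) * ln (real (card (generate G S)) / real (card A))
    \<le> real (edge_boundary G S A)"
proof -
  have "finite S" using assms(4) fin finite_subset by blast
  then show ?thesis using assms(4,5)
  proof (induction S arbitrary: A rule: finite_induct)
    case empty
    then have "A = {} \<or> A = {\<one>}" by (auto simp: generate_empty)
    then show ?case by (auto simp: generate_empty)
  next
    case (insert s S)
    have S: "S \<subseteq> carrier G" and s: "s \<in> carrier G" using insert.prems by auto
    define H K where "H = generate G S" and "K = generate G (insert s S)"
    have H: "subgroup H G" unfolding H_def using generate_is_subgroup S by auto
    have K: "subgroup K G" unfolding K_def using generate_is_subgroup insert.prems by auto
    note Hc = subgroup.mem_carrier[OF H]
    have finH: "finite H" using finite_subset[OF subgroup.subset[OF H] fin] .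
    have AK: "A \<subseteq> K" using insert.prems by (simp add: K_def)
    have finA: "finite A"
      using finite_subset[OF AK finite_subset[OF subgroup.subset[OF K] fin]] .
    obtain k :: nat where k: "0 < k" "k \<le> ord s" "s [^] k \<in> H"
      and bij: "bij_betw (\<lambda>(i, h). s [^] i \<otimes> h) ({..<k} \<times> H) K"
      unfolding H_def K_def by (rule generate_insert_slices[OF fin S s])
    have "ord s \<le> m" using exponent s \<open>0 < m\<close> by (intro dvd_imp_le) (auto simp: pow_eq_id)
    then have km: "k \<le> m" using k by simp
    have cardK: "card K = k * card H"
      using bij_betw_same_card[OF bij] by (simp add: card_cartesian_product)

    \<comment> \<open>Slices are translated back into \<open>H\<close>, where the induction
      hypothesis applies.\<close>
    define A' where "A' i = {h \<in> H. s [^] i \<otimes> h \<in> A}" for i :: nat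
    define c where "c i = real (card (A' i))" for i
    have finA': "finite (A' i)" for i using finH by (simp add: A'_def)
    have cardA: "real (card A) = (\<Sum>i<k. c i)"
      using card_eq_sum_slices[OF bij finH AK] by (simp add: c_def A'_def)
    \<comment> \<open>Slice \<open>k\<close> is slice 0 moved within \<open>H\<close> by the inverse
      of \<open>s [^] k\<close>, which closes the cycle.\<close>
    have "card (A' 0) = card (A' k)"
    proof (rule bij_betw_same_card[of "\<lambda>h. inv (s [^] k) \<otimes> h"],
        rule bij_betw_byWitness[of _ "\<lambda>h. s [^] k \<otimes> h"])
      have kc: "s [^] k \<in> carrier G" "inv (s [^] k) \<in> H"
        using s k H by (auto intro: subgroup.m_inv_closed)
      show "(\<lambda>h. inv (s [^] k) \<otimes> h) ` A' 0 \<subseteq> A' k" "(\<lambda>h. s [^] k \<otimes> h) ` A' k \<subseteq> A' 0"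
        using kc k subgroup.m_closed[OF H] Hc by (auto simp: A'_def m_assoc[symmetric])
      show "\<forall>h\<in>A' 0. s [^] k \<otimes> (inv (s [^] k) \<otimes> h) = h"
        "\<forall>h\<in>A' k. inv (s [^] k) \<otimes> (s [^] k \<otimes> h) = h"
        using kc Hc by (auto simp: A'_def m_assoc[symmetric])
    qed
    then have cyclic: "c k = c 0" by (simp add: c_def)

    \<comment> \<open>Multiplication by \<open>t \<in> H\<close> stays within a slice, whereas in
      \<open>edges_s\<close> multiplication by \<open>s\<close> leads from slice \<open>i\<close> to
      slice \<open>Suc i\<close>.\<close>
    have edges_S: "card {a \<in> A. a \<otimes> t \<notin> A} = (\<Sum>i<k. card {h \<in> A' i. h \<otimes> t \<notin> A' i})"
      if "t \<in> S" for t
    proof -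
      have t: "t \<in> H" using that by (simp add: H_def generate.incl)
      have "{h \<in> H. s [^] i \<otimes> h \<in> {a \<in> A. a \<otimes> t \<notin> A}} = {h \<in> A' i. h \<otimes> t \<notin> A' i}" for i
        using s t Hc subgroup.m_closed[OF H] by (auto simp: A'_def m_assoc)
      moreover have "{a \<in> A. a \<otimes> t \<notin> A} \<subseteq> K" using AK by auto
      ultimately show ?thesis using card_eq_sum_slices[OF bij finH] by simp
    qed
    have edges_s: "card {a \<in> A. a \<otimes> s \<notin> A} = (\<Sum>i<k. card (A' i - A' (Suc i)))"
    proof -
      have "s [^] i \<otimes> h \<otimes> s = s [^] Suc i \<otimes> h" if "h \<in> H" for i h
        using s Hc[OF that] by (simp add: m_ac)
      then have "{h \<in> H. s [^] i \<otimes> h \<in> {a \<in> A. a \<otimes> s \<notin> A}} = A' i - A' (Suc i)" for i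
        by (auto simp: A'_def)
      moreover have "{a \<in> A. a \<otimes> s \<notin> A} \<subseteq> K" using AK by auto
      ultimately show ?thesis using card_eq_sum_slices[OF bij finH] by simp
    qed
    have split: "edge_boundary G (insert s S) A
      = (\<Sum>i<k. card (A' i - A' (Suc i))) + (\<Sum>i<k. edge_boundary G S (A' i))"
    proof -
      have "(\<Sum>t\<in>S. card {a \<in> A. a \<otimes> t \<notin> A}) = (\<Sum>i<k. edge_boundary G S (A' i))"
        using insert.hyps finA'
        by (simp add: edges_S edge_boundary_eq_sum sum.swap[of _ S])
      then show ?thesis
        using insert.hyps finA by (simp add: edge_boundary_eq_sum edges_s)
    qed

    define a b where "a = Min (c ` {..<k})" and "b = Max (c ` {..<k})"
    have nonempty: "c ` {..<k} \<noteq> {}" using k by auto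
    have range: "a \<le> c i \<and> c i \<le> b" if "i < k" for i
      using that by (auto simp: a_def b_def)
    obtain p q where pq: "p < k" "b = c p" "q < k" "a = c q"
      using Min_in[OF _ nonempty] Max_in[OF _ nonempty] by (auto simp: a_def b_def)
    have ge_s: "b - a \<le> (\<Sum>i<k. real (card (A' i - A' (Suc i))))"
      unfolding pq
    proof (rule cyclic_diff_le_sum_descents)
      fix i
      have "card (A' i) - card (A' (Suc i)) \<le> card (A' i - A' (Suc i))"
        using finA' by (intro diff_card_le_card_Diff)
      then show "c i - c (Suc i) \<le> real (card (A' i - A' (Suc i)))"
        by (simp add: c_def)
    qed (use pq cyclic in auto)

    have ge_S: "(\<Sum>i<k. exp 1 / m * c i * ln (card H / c i))
      \<le> (\<Sum>i<k. real (edge_boundary G S (A' i)))"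
      unfolding H_def c_def
      by (intro sum_mono insert.IH S) (auto simp: A'_def H_def)

    define \<mu> where "\<mu> = (\<Sum>i<k. c i) / k"
    have \<mu>: "\<mu> > 0" if "i < k" "c i \<noteq> 0" for i
    proof -
      have "0 < (\<Sum>i<k. c i)"
        using that by (intro sum_pos2[of _ i]) (auto simp: c_def)
      then show ?thesis using k by (simp add: \<mu>_def)
    qed
    \<comment> \<open>The logarithm splits into the part for the induction hypothesis and the Jensen
      gap; for an empty slice all products are 0.\<close>
    have "card H > 0" using finH subgroup.one_closed[OF H] by (auto simp: card_gt_0_iff)
    then have termwise: "c i * ln (card H / \<mu>) = c i * ln (card H / c i) + c i * ln (c i / \<mu>)"
      if "i < k" for i
      using \<mu>[OF that] by (cases "c i = 0") (auto simp: c_def ln_div algebra_simps)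
    have ratio: "card K / card A = card H / \<mu>"
      using k by (simp add: cardK cardA \<mu>_def)
    have "card A * ln (card K / card A) = (\<Sum>i<k. c i * ln (card H / \<mu>))"
      unfolding ratio by (simp add: cardA sum_distrib_right)
    also have "\<dots> = (\<Sum>i<k. c i * ln (card H / c i)) + (\<Sum>i<k. c i * ln (c i / \<mu>))"
      by (simp add: termwise sum.distrib)
    also have "(\<Sum>i<k. c i * ln (c i / \<mu>)) \<le> k * (b - a) / exp 1"
      unfolding \<mu>_def using k range pq by (intro sum_mult_ln_mean_le) (auto simp: c_def)
    \<comment> \<open>The exponent enters here through \<open>k \<le> m\<close>. The factor
      \<open>exp 1 / m\<close> then turns this term into exactly \<open>b - a\<close>, which the
      edges in direction \<open>s\<close> cover.\<close>
    also have "\<dots> \<le> m * (b - a) / exp 1"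
      using km range[OF k(1)] by (intro divide_right_mono mult_right_mono) auto
    finally have "exp 1 / m * (card A * ln (card K / card A))
      \<le> exp 1 / m * ((\<Sum>i<k. c i * ln (card H / c i)) + m * (b - a) / exp 1)"
      by (intro mult_left_mono) auto
    also have "\<dots> = (\<Sum>i<k. exp 1 / m * c i * ln (card H / c i)) + (b - a)"
      using \<open>0 < m\<close> by (simp add: distrib_left sum_distrib_left mult.assoc)
    also have "\<dots> \<le> real (edge_boundary G (insert s S) A)"
      using ge_s ge_S by (simp add: split)
    finally show ?case by (simp add: K_def mult.assoc)
  qed
qed

theorem theorem1:
  fixes G :: "('a, 'b) monoid_scheme" and m :: nat and A S :: "'a set"
  assumes "m \<ge> 2"
    and "comm_group G"
    and "finite (carrier G)"
    and "group_exponent G dvd m"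
    and "A \<subseteq> carrier G"
    and "A \<noteq> {}"
    and "S \<subseteq> carrier G"
    and "generate G S = carrier G"
  shows "real (edge_boundary G S A)
           \<ge> exp 1 / real m * real (card A) * ln (real (order G) / real (card A))"
proof -
  interpret comm_group G by fact
  show ?thesis
    using edge_boundary_generate_ge[of m S A] assms
    by (simp add: order_def group_exponent_dvd_iff)
qed

end
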